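(* Let $G=(\mathcal V,\mathcal E)$ be a finite undirected graph with finite label sets and potentials $\theta$. Let $A\subset\mathcal V$ and let $y\in X_{\mathcal V}$ be a test labeling. Let $\psi$ be the reparametrization $\psi_{v,u}(x_v)=-\theta_{uv}(y_u,x_v)$ for all $uv\in\mathcal E$ (both orientations), $x_v\in X_v$, and let $p$ be the mapping $$p_v(i)=\begin{cases}y_v,&v\in A,\\ i,&v\notin A.\end{cases}$$ Then the relaxed persistency criterion with reparametrized potentials, $$\delta(y|_A)\in\operatorname*{arg\,min}_{\mu\in\Lambda_A}\hat E^\psi_{A,y|_A}(\mu),$$ holds if and only if $p$ is $\Lambda_{\mathcal V}$-improving for $\theta$.
   Context: For $A\subset\mathcal V$, $X_A=\prod_{v\in A}X_v$, with label sets finite and nonempty, and $\theta_{uv}(x_u,x_v)=\theta_{vu}(x_v,x_u)$. $E_A(x)=\sum_{u\in A}\theta_u(x_u)+\sum_{uv\in\mathcal E:\,u,v\in A}\theta_{uv}(x_u,x_v)$. Boundary nodes: $\partial\mathcal V_A=\{u\in A:\exists v\in\mathcal V\setminus A,\ uv\in\mathcal E\}$; boundary edges: $\partial\mathcal E_A=\{uv\in\mathcal E:u\in A,\ v\in\mathcal V\setminus A\}$. For $uv\in\partial\mathcal E_A$ with $u\in A$ and a test label $y_u$: $\hat\theta_{uv,y_u}(x_u)=\max_{x_v\in X_v}\theta_{uv}(x_u,x_v)$ if $x_u=y_u$, and $\hat\theta_{uv,y_u}(x_u)=\min_{x_v\in X_v}\theta_{uv}(x_u,x_v)$ if $x_u\neq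 y_u$. $\hat E_{A,y}(x)=E_A(x)+\sum_{uv\in\partial\mathcal E_A:\,u\in\partial\mathcal V_A}\hat\theta_{uv,y_u}(x_u)$ (only the restriction of $y$ to $\partial\mathcal V_A$ matters). The local polytope $\Lambda_A$ is the set of nonnegative vectors $\mu$ with components $\mu_v(x_v)$ ($v\in A$, $x_v\in X_v$) and $\mu_{uv}(x_u,x_v)$ ($uv\in\mathcal E$, $u,v\in A$) such that $\sum_{x_v\in X_v}\mu_v(x_v)=1$, $\sum_{x_v\in X_v}\mu_{uv}(x_u,x_v)=\mu_u(x_u)$ and $\sum_{x_u\in X_u}\mu_{uv}(x_u,x_v)=\mu_v(x_v)$. For $x\in X_A$, $\delta(x)\in\Lambda_A$ is its indicator vector. Energies that are sums of unary and pairwise terms are extended linearly to $\Lambda_A$ (each $f_v$ becomes $\sum_{x_v}f_v(x_v)\mu_v(x_v)$, each $f_{uv}$ becomes $\sum_{x_u,x_v}f_{uv}(x_u,x_v)\mu_{uv}(x_u,x_v)$); write $E_{\mathcal V}(\mu)=\langle\theta,\mu\rangle$ with $\theta,\mu\in\mathbb R^{\mathcal I}$, $|\mathcal I|=\sum_{v}|X_v|+\sum_{uv}|X_u||X_v|$. A reparametrization is a vector $\varphi$ of reals $\varphi_{v,u}(x_v)$; $\theta^\varphi_v(x_v)=\theta_v(x_v)-\sum_{u:\,uv\in\mathcal E}\varphi_{v,u}(x_v)$, $\theta^\varphi_{uv}(x_u,x_v)=\theta_{uv}(x_u,x_v)+\varphi_{v,u}(x_v)+\varphi_{u,v}(x_u)$.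 $\hat E^\varphi_{A,y}$ denotes $\hat E_{A,y}$ constructed from $\theta^\varphi$. For a node-wise mapping $p:X_{\mathcal V}\to X_{\mathcal V}$, $p(x)_v=p_v(x_v)$ with each $p_v:X_v\to X_v$ idempotent, let $P_v\in\mathbb R^{X_v\times X_v}$ have entries $P_{v,ii'}=1$ if $p_v(i')=i$ and $0$ otherwise. The linear extension $[p]:\mathbb R^{\mathcal I}\to\mathbb R^{\mathcal I}$ is $([p]\mu)_v=P_v\mu_v$, $([p]\mu)_{uv}=P_u\mu_{uv}P_v^\top$. $p$ is $\Lambda_{\mathcal V}$-improving for $\theta$ if $\min_{\mu\in\Lambda_{\mathcal V}}\langle(I-[p])^\top\theta,\mu\rangle=0$. *)

theory Defs
  imports Complex_Main
begin

text \<open>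
  A graph is given by a vertex set \<open>V\<close> and a set \<open>E\<close> of two-element subsets of \<open>V\<close>; the label set
  of a node \<open>v\<close> is \<open>X v\<close>. A vector with unary and pairwise components (potentials as well as
  relaxed labelings) is stored with the pairwise block in both orientations, tied together by
  \<open>pw_symmetric\<close>. Components at indices outside the graph or the label sets are never looked at.
\<close>

datatype ('v, 'l) pvec =
  PVec (un: "'v \<Rightarrow> 'l \<Rightarrow> real") (pw: "'v \<Rightarrow> 'v \<Rightarrow> 'l \<Rightarrow> 'l \<Rightarrow> real")

definition pw_symmetric :: "'v set set \<Rightarrow> ('v \<Rightarrow> 'l set) \<Rightarrow> ('v, 'l) pvec \<Rightarrow> bool" where
  "pw_symmetric E X f \<longleftrightarrow>
     (\<forall>u v. {u, v} \<in> E \<longrightarrow> (\<forall>a\<in>X u. \<forall>b\<in>X v. pw f u v a b = pw f v u b a))"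

definition edges_in :: "'v set set \<Rightarrow> 'v set \<Rightarrow> 'v set set" where
  "edges_in E A = {e \<in> E. e \<subseteq> A}"

text \<open>
  Every undirected edge is counted once, in an arbitrary orientation; for summands invariant under
  swapping the endpoints the choice is immaterial (lemma \<open>edge_term_eq\<close>).
\<close>

definition edge_term :: "('v \<Rightarrow> 'v \<Rightarrow> real) \<Rightarrow> 'v set \<Rightarrow> real" where
  "edge_term g e = (case (SOME (u, v). e = {u, v}) of (u, v) \<Rightarrow> g u v)"

definition edge_sum :: "'v set set \<Rightarrow> ('v \<Rightarrow> 'v \<Rightarrow> real) \<Rightarrow> real" where
  "edge_sum F g = (\<Sum>e\<in>F. edge_term g e)"

lemma edge_term_ends:
  obtains u' v' where "{u', v'} = {u, v}" "edge_term g {u, v} = g u' v'"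
proof -
  define q where "q = (SOME (u', v'). {u, v} = {u', v'})"
  have "case q of (u', v') \<Rightarrow> {u, v} = {u', v'}"
    unfolding q_def by (rule someI[where x = "(u, v)"]) simp
  then show thesis
    using that unfolding edge_term_def q_def[symmetric] by (cases q) auto
qed

lemma edge_term_eq:
  assumes "g u v = g v u"
  shows "edge_term g {u, v} = g u v"
proof -
  obtain u' v' where "{u', v'} = {u, v}" "edge_term g {u, v} = g u' v'"
    by (rule edge_term_ends)
  with assms show ?thesis by (auto simp: doubleton_eq_iff)
qed

text \<open>The linear extension of \<open>E\<^sub>A\<close>; for \<open>A = V\<close> it is the inner product of \<open>f\<close> and \<open>\<mu>\<close>.\<close>

definition lin_energy ::
  "'v set set \<Rightarrow> ('v \<Rightarrow> 'l set) \<Rightarrow> 'v set \<Rightarrow> ('v, 'l) pvec \<Rightarrow> ('v, 'l) pvec \<Rightarrow> real" where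
  "lin_energy E X A f \<mu> =
     (\<Sum>v\<in>A. \<Sum>a\<in>X v. un f v a * un \<mu> v a)
     + edge_sum (edges_in E A) (\<lambda>u v. \<Sum>a\<in>X u. \<Sum>b\<in>X v. pw f u v a b * pw \<mu> u v a b)"

definition local_polytope ::
  "'v set set \<Rightarrow> ('v \<Rightarrow> 'l set) \<Rightarrow> 'v set \<Rightarrow> ('v, 'l) pvec set" where
  "local_polytope E X A = {\<mu>.
     pw_symmetric (edges_in E A) X \<mu>
     \<and> (\<forall>v\<in>A. \<forall>a\<in>X v. 0 \<le> un \<mu> v a)
     \<and> (\<forall>u v. {u, v} \<in> edges_in E A \<longrightarrow> (\<forall>a\<in>X u. \<forall>b\<in>X v. 0 \<le> pw \<mu> u v a b))
     \<and> (\<forall>v\<in>A. (\<Sum>a\<in>X v. un \<mu> v a) = 1)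
     \<and> (\<forall>u v. {u, v} \<in> edges_in E A \<longrightarrow>
           (\<forall>a\<in>X u. (\<Sum>b\<in>X v. pw \<mu> u v a b) = un \<mu> u a)
         \<and> (\<forall>b\<in>X v. (\<Sum>a\<in>X u. pw \<mu> u v a b) = un \<mu> v b))}"

definition indicator_vec :: "('v \<Rightarrow> 'l) \<Rightarrow> ('v, 'l) pvec" where
  "indicator_vec x =
     PVec (\<lambda>v a. of_bool (x v = a)) (\<lambda>u v a b. of_bool (x u = a \<and> x v = b))"

lemma lin_energy_indicator:
  assumes E: "\<And>e. e \<in> E \<Longrightarrow> card e = 2"
    and X: "\<And>v. v \<in> A \<Longrightarrow> finite (X v)" and x: "\<And>v. v \<in> A \<Longrightarrow> x v \<in> X v"
  shows "lin_energy E X A f (indicator_vec x) =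
     (\<Sum>v\<in>A. un f v (x v)) + edge_sum (edges_in E A) (\<lambda>u v. pw f u v (x u) (x v))"
proof -
  have 1: "(\<Sum>a\<in>X v. un f v a * of_bool (x v = a)) = un f v (x v)" if "v \<in> A" for v
    using X[OF that] x[OF that] by (simp add: of_bool_def if_distrib cong: if_cong)
  have 2: "(\<Sum>a\<in>X u. \<Sum>b\<in>X v. pw f u v a b * of_bool (x u = a \<and> x v = b)) = pw f u v (x u) (x v)"
    if "u \<in> A" "v \<in> A" for u v
  proof -
    have "(\<Sum>b\<in>X v. pw f u v a b * of_bool (x u = a \<and> x v = b)) =
          (if x u = a then pw f u v a (x v) else 0)" for a
      using X[OF that(2)] x[OF that(2)] by (simp add: of_bool_def if_distrib cong: if_cong)
    then show ?thesis using X[OF that(1)] x[OF that(1)] by simp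
  qed
  have 3: "edge_term g e = edge_term h e"
    if e: "e \<in> edges_in E A" and gh: "\<And>u v. u \<in> A \<Longrightarrow> v \<in> A \<Longrightarrow> g u v = h u v"
    for e and g h :: "'a \<Rightarrow> 'a \<Rightarrow> real"
  proof -
    from e E obtain u v where uv: "e = {u, v}" unfolding edges_in_def card_2_iff by blast
    define q where "q = (SOME (u, v). e = {u, v})"
    have "case q of (u, v) \<Rightarrow> e = {u, v}"
      unfolding q_def by (rule someI[where x = "(u, v)"]) (simp add: uv)
    with e gh show ?thesis
      unfolding edge_term_def q_def[symmetric] edges_in_def by (cases q) auto
  qed
  show ?thesis
    unfolding lin_energy_def edge_sum_def indicator_vec_def
    by (intro arg_cong2[where f = "(+)"] sum.cong refl 3) (simp_all add: 1 2)
qed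

text \<open>Boundary edges are oriented from the endpoint inside \<open>A\<close> to the endpoint outside \<open>A\<close>.\<close>

definition boundary_edges :: "'v set \<Rightarrow> 'v set set \<Rightarrow> 'v set \<Rightarrow> ('v \<times> 'v) set" where
  "boundary_edges V E A = {(u, v). u \<in> A \<and> v \<in> V - A \<and> {u, v} \<in> E}"

definition boundary_pot ::
  "('v \<Rightarrow> 'l set) \<Rightarrow> ('v, 'l) pvec \<Rightarrow> 'v \<Rightarrow> 'v \<Rightarrow> 'l \<Rightarrow> 'l \<Rightarrow> real" where
  "boundary_pot X \<theta> u v yu a =
     (if a = yu then Max (pw \<theta> u v a ` X v) else Min (pw \<theta> u v a ` X v))"

definition hat_energy ::
  "'v set \<Rightarrow> 'v set set \<Rightarrow> ('v \<Rightarrow> 'l set) \<Rightarrow> 'v set \<Rightarrow> ('v \<Rightarrow> 'l) \<Rightarrow>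
   ('v, 'l) pvec \<Rightarrow> ('v, 'l) pvec \<Rightarrow> real" where
  "hat_energy V E X A y \<theta> \<mu> =
     lin_energy E X A \<theta> \<mu>
     + (\<Sum>(u, v)\<in>boundary_edges V E A. \<Sum>a\<in>X u. boundary_pot X \<theta> u v (y u) a * un \<mu> u a)"

text \<open>\<open>\<phi> v u a\<close> is the component \<open>\<phi>\<close> of the pair \<open>(v, u)\<close> at the label \<open>a\<close> of the first node \<open>v\<close>.\<close>

definition reparam ::
  "'v set set \<Rightarrow> ('v \<Rightarrow> 'v \<Rightarrow> 'l \<Rightarrow> real) \<Rightarrow> ('v, 'l) pvec \<Rightarrow> ('v, 'l) pvec" where
  "reparam E \<phi> \<theta> =
     PVec (\<lambda>v a. un \<theta> v a - (\<Sum>u | {u, v} \<in> E. \<phi> v u a))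
          (\<lambda>u v a b. pw \<theta> u v a b + \<phi> v u b + \<phi> u v a)"

definition map_matrix :: "('v \<Rightarrow> 'l \<Rightarrow> 'l) \<Rightarrow> 'v \<Rightarrow> 'l \<Rightarrow> 'l \<Rightarrow> real" where
  "map_matrix p v i j = of_bool (p v j = i)"

definition lin_ext ::
  "('v \<Rightarrow> 'l set) \<Rightarrow> ('v \<Rightarrow> 'l \<Rightarrow> 'l) \<Rightarrow> ('v, 'l) pvec \<Rightarrow> ('v, 'l) pvec" where
  "lin_ext X p \<mu> =
     PVec (\<lambda>v i. \<Sum>j\<in>X v. map_matrix p v i j * un \<mu> v j)
          (\<lambda>u v i i'. \<Sum>j\<in>X u. \<Sum>j'\<in>X v.
              map_matrix p u i j * pw \<mu> u v j j' * map_matrix p v i' j')"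

text \<open>
  The transpose of \<open>lin_ext\<close>, i.e. \<open>P\<^sub>v\<close> is replaced by its transpose in every block; lemma
  \<open>lin_ext_transpose_adjoint\<close> confirms that it is the adjoint with respect to the inner product.
\<close>

definition lin_ext_transpose ::
  "('v \<Rightarrow> 'l set) \<Rightarrow> ('v \<Rightarrow> 'l \<Rightarrow> 'l) \<Rightarrow> ('v, 'l) pvec \<Rightarrow> ('v, 'l) pvec" where
  "lin_ext_transpose X p \<theta> =
     PVec (\<lambda>v j. \<Sum>i\<in>X v. map_matrix p v i j * un \<theta> v i)
          (\<lambda>u v j j'. \<Sum>i\<in>X u. \<Sum>i'\<in>X v.
              map_matrix p u i j * pw \<theta> u v i i' * map_matrix p v i' j')"

lemma lin_ext_transpose_adjoint:
  "lin_energy E X A (lin_ext_transpose X p \<theta>) \<mu> = lin_energy E X A \<theta> (lin_ext X p \<mu>)"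
proof -
  have "(\<Sum>j\<in>X v. (\<Sum>i\<in>X v. map_matrix p v i j * un \<theta> v i) * un \<mu> v j) =
        (\<Sum>i\<in>X v. un \<theta> v i * (\<Sum>j\<in>X v. map_matrix p v i j * un \<mu> v j))" for v
    unfolding sum_distrib_left sum_distrib_right
    by (subst sum.swap) (simp add: mult_ac)
  moreover have
    "(\<Sum>j\<in>X u. \<Sum>j'\<in>X v.
        (\<Sum>i\<in>X u. \<Sum>i'\<in>X v. map_matrix p u i j * pw \<theta> u v i i' * map_matrix p v i' j')
        * pw \<mu> u v j j') =
     (\<Sum>i\<in>X u. \<Sum>i'\<in>X v. pw \<theta> u v i i' *
        (\<Sum>j\<in>X u. \<Sum>j'\<in>X v. map_matrix p u i j * pw \<mu> u v j j' * map_matrix p v i' j'))"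
    for u v
    unfolding sum_distrib_left sum_distrib_right sum.cartesian_product
    by (rule sum.reindex_bij_witness[where i = "\<lambda>(i, i', j, j'). (j, j', i, i')"
          and j = "\<lambda>(j, j', i, i'). (i, i', j, j')"]) (auto simp: mult_ac)
  ultimately show ?thesis
    by (simp add: lin_energy_def lin_ext_def lin_ext_transpose_def)
qed

definition pvec_diff :: "('v, 'l) pvec \<Rightarrow> ('v, 'l) pvec \<Rightarrow> ('v, 'l) pvec" where
  "pvec_diff f g =
     PVec (\<lambda>v a. un f v a - un g v a) (\<lambda>u v a b. pw f u v a b - pw g u v a b)"

definition improving ::
  "'v set \<Rightarrow> 'v set set \<Rightarrow> ('v \<Rightarrow> 'l set) \<Rightarrow> ('v \<Rightarrow> 'l \<Rightarrow> 'l) \<Rightarrow> ('v, 'l) pvec \<Rightarrow> bool" where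
  "improving V E X p \<theta> \<longleftrightarrow>
     (let c = lin_energy E X V (pvec_diff \<theta> (lin_ext_transpose X p \<theta>))
      in \<exists>\<mu>. is_arg_min c (\<lambda>\<mu>. \<mu> \<in> local_polytope E X V) \<mu> \<and> c \<mu> = 0)"

end

theory Submission
  imports Defs
begin

text \<open>
  With the reparametrization, the energy of the criterion at \<open>\<mu>\<close> minus its value at \<open>y\<close> is the change of
  \<open>E\<^sub>A\<close> plus, for every boundary edge \<open>(u, v)\<close> and label \<open>a\<close> of \<open>u\<close>, the weight \<open>\<mu>\<^sub>u(a)\<close> times the
  minimum over \<open>b\<close> of \<open>\<theta>\<^sub>u\<^sub>v(a, b) - \<theta>\<^sub>u\<^sub>v(y\<^sub>u, b)\<close>. The improving objective at a \<open>\<mu>\<close> on all of \<open>V\<close> has the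
  same form with that minimum replaced by an average over \<open>b\<close>, hence dominates it. The minimizing \<open>b\<close>
  of different edges at a common outer node may disagree, so the minima need not be attained by an
  extension of \<open>\<mu>\<close> itself; but both sides are affine and vanish at \<open>y\<close>, so only their signs near \<open>y\<close>
  matter, and there an extension attaining all minima exists.
\<close>

section \<open>Sums over undirected edges\<close>

text \<open>The orientation picked by \<open>SOME\<close> is unknown, but the first hypothesis
  covers every ordered pair whose underlying set lies in \<open>F\<close>, hence whichever one is
  picked.\<close>

lemma edge_sum_cong:
  assumes "\<And>u v. {u, v} \<in> F \<Longrightarrow> g u v = h u v" "\<And>e. e \<in> F \<Longrightarrow> card e = 2"
  shows "edge_sum F g = edge_sum F h"
  unfolding edge_sum_def
proof (rule sum.cong[OF refl])
  fix e assume e: "e \<in> F"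
  then obtain u v where "e = {u, v}" using assms(2) by (meson card_2_iff)
  define q where "q = (SOME (u, v). e = {u, v})"
  have "case q of (u, v) \<Rightarrow> e = {u, v}"
    unfolding q_def by (rule someI[where x = "(u, v)"]) (simp add: \<open>e = {u, v}\<close>)
  then show "edge_term g e = edge_term h e"
    using e assms(1) unfolding edge_term_def q_def[symmetric] by (cases q) auto
qed

lemma edge_sum_add: "edge_sum F (\<lambda>u v. g u v + h u v) = edge_sum F g + edge_sum F h"
  unfolding edge_sum_def sum.distrib[symmetric] edge_term_def
  by (rule sum.cong) (auto split: prod.split)

lemma edge_sum_scale: "edge_sum F (\<lambda>u v. c * g u v) = c * edge_sum F g"
  unfolding edge_sum_def sum_distrib_left edge_term_def
  by (rule sum.cong) (auto split: prod.split)

lemma edge_sum_diff: "edge_sum F (\<lambda>u v. g u v - h u v) = edge_sum F g - edge_sum F h"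
  using edge_sum_add[of F "\<lambda>u v. g u v - h u v" h] by simp

text \<open>A summand that adds up both orientations no longer depends on the orientation chosen.
  Since \<open>card e = 2\<close>, the two arcs of an edge are distinct, so neither is lost in the
  set of arcs.\<close>

lemma edge_sum_arcs:
  assumes "finite F" "\<And>e. e \<in> F \<Longrightarrow> card e = 2"
  shows "edge_sum F (\<lambda>u v. h u v + h v u) = (\<Sum>(u, v) | {u, v} \<in> F. h u v)"
    and "finite {(u, v). {u, v} \<in> F}"
proof -
  have "edge_sum F (\<lambda>u v. h u v + h v u) = (\<Sum>(u, v) | {u, v} \<in> F. h u v)
    \<and> finite {(u, v). {u, v} \<in> F}"
    using assms
  proof (induction F rule: finite_induct)
    case empty
    then show ?case by (simp add: edge_sum_def)
  next
    case (insert e F)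
    have "card e = 2" using insert.prems by simp
    then obtain u v where e: "e = {u, v}" "u \<noteq> v" by (meson card_2_iff)
    let ?A = "{(u, v). {u, v} \<in> F}"
    have IH: "edge_sum F (\<lambda>u v. h u v + h v u) = (\<Sum>(u, v)\<in>?A. h u v)" "finite ?A"
      using insert.IH insert.prems by auto
    have arcs: "{(u, v). {u, v} \<in> insert e F} = insert (u, v) (insert (v, u) ?A)"
      using e by (auto simp: doubleton_eq_iff insert_commute)
    have notin: "(u, v) \<notin> insert (v, u) ?A" "(v, u) \<notin> ?A"
      using e insert.hyps by (auto simp: insert_commute)
    have "edge_sum (insert e F) (\<lambda>u v. h u v + h v u)
        = h u v + h v u + edge_sum F (\<lambda>u v. h u v + h v u)"
      using insert.hyps e edge_term_eq[of "\<lambda>u v. h u v + h v u" u v]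
      by (simp add: edge_sum_def add.commute)
    then show ?case
      unfolding arcs using IH notin by simp
  qed
  then show "edge_sum F (\<lambda>u v. h u v + h v u) = (\<Sum>(u, v) | {u, v} \<in> F. h u v)"
    and "finite {(u, v). {u, v} \<in> F}" by auto
qed

section \<open>Relaxed labelings and the local polytope\<close>

lemma local_polytopeD:
  assumes "\<mu> \<in> local_polytope E X A"
  shows "\<And>v a. v \<in> A \<Longrightarrow> a \<in> X v \<Longrightarrow> 0 \<le> un \<mu> v a"
    and "\<And>v. v \<in> A \<Longrightarrow> (\<Sum>a\<in>X v. un \<mu> v a) = 1"
    and "\<And>u v a b. {u, v} \<in> edges_in E A \<Longrightarrow> a \<in> X u \<Longrightarrow> b \<in> X v \<Longrightarrow> pw \<mu> u v a b = pw \<mu> v u b a"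
    and "\<And>u v a b. {u, v} \<in> edges_in E A \<Longrightarrow> a \<in> X u \<Longrightarrow> b \<in> X v \<Longrightarrow> 0 \<le> pw \<mu> u v a b"
    and "\<And>u v a. {u, v} \<in> edges_in E A \<Longrightarrow> a \<in> X u \<Longrightarrow> (\<Sum>b\<in>X v. pw \<mu> u v a b) = un \<mu> u a"
    and "\<And>u v b. {u, v} \<in> edges_in E A \<Longrightarrow> b \<in> X v \<Longrightarrow> (\<Sum>a\<in>X u. pw \<mu> u v a b) = un \<mu> v b"
  using assms unfolding local_polytope_def pw_symmetric_def by blast+

text \<open>Components outside the smaller node set are never inspected, so a relaxed labeling
  serves as its own restriction.\<close>

lemma local_polytope_mono:
  assumes "A \<subseteq> B"
  shows "local_polytope E X B \<subseteq> local_polytope E X A"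
proof -
  have "{u, v} \<in> edges_in E A \<Longrightarrow> {u, v} \<in> edges_in E B" for u v
    using assms by (auto simp: edges_in_def)
  then show ?thesis
    using assms unfolding local_polytope_def pw_symmetric_def by blast
qed

lemma sum_of_bool_mult:
  assumes "finite S" "x \<in> S"
  shows "(\<Sum>a\<in>S. of_bool (x = a) * f a) = (f x :: real)"
    "(\<Sum>a\<in>S. f a * of_bool (x = a)) = f x"
    "(\<Sum>a\<in>S. of_bool (x = a) :: real) = 1"
proof -
  have "of_bool (x = a) * g a = (if x = a then g a else 0)" for a and g :: "'a \<Rightarrow> real"
    by simp
  then have *: "(\<Sum>a\<in>S. of_bool (x = a) * g a) = g x" for g :: "'a \<Rightarrow> real"
    using assms by simp
  show "(\<Sum>a\<in>S. of_bool (x = a) * f a) = f x" by (rule *)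
  then show "(\<Sum>a\<in>S. f a * of_bool (x = a)) = f x" by (simp only: mult.commute)
  show "(\<Sum>a\<in>S. of_bool (x = a) :: real) = 1" using *[of "\<lambda>_. 1"] by simp
qed

lemma sum_of_bool_conj_mult:
  assumes "finite S" "x \<in> S" "finite T" "z \<in> T"
  shows "(\<Sum>a\<in>S. \<Sum>b\<in>T. of_bool (x = a \<and> z = b) * f a b) = (f x z :: real)"
proof -
  have "(\<Sum>a\<in>S. \<Sum>b\<in>T. of_bool (x = a \<and> z = b) * f a b)
      = (\<Sum>a\<in>S. of_bool (x = a) * (\<Sum>b\<in>T. of_bool (z = b) * f a b))"
    by (simp add: of_bool_conj sum_distrib_left mult.assoc)
  then show ?thesis using assms by (simp add: sum_of_bool_mult)
qed

lemma indicator_vec_in_local_polytope: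
  assumes "\<And>v. v \<in> A \<Longrightarrow> finite (X v) \<and> x v \<in> X v"
  shows "indicator_vec x \<in> local_polytope E X A"
proof -
  have e: "u \<in> A \<and> v \<in> A" if "{u, v} \<in> edges_in E A" for u v
    using that by (auto simp: edges_in_def)
  show ?thesis
    using assms
    by (auto simp: local_polytope_def pw_symmetric_def indicator_vec_def of_bool_conj
        sum_of_bool_mult sum_distrib_left[symmetric] sum_distrib_right[symmetric] mult.commute dest!: e)
qed

section \<open>Inner edges and boundary edges of \<open>A\<close>\<close>

locale test_labeling =
  fixes V A :: "'v set" and E :: "'v set set" and X :: "'v \<Rightarrow> 'l set"
    and \<theta> :: "('v, 'l) pvec" and y :: "'v \<Rightarrow> 'l"
  assumes finV: "finite V"
    and E: "\<And>e. e \<in> E \<Longrightarrow> e \<subseteq> V \<and> card e = 2"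
    and X: "\<And>v. v \<in> V \<Longrightarrow> finite (X v) \<and> X v \<noteq> {}"
    and sym: "pw_symmetric E X \<theta>"
    and AV: "A \<subseteq> V"
    and y: "\<And>v. v \<in> V \<Longrightarrow> y v \<in> X v"
begin

lemma finE: "finite E"
  by (rule finite_subset[of _ "Pow V"]) (use E finV in auto)

lemma edge_ends:
  assumes "{u, v} \<in> E"
  shows "u \<in> V" "v \<in> V" "u \<noteq> v"
  using E[OF assms] by auto

lemma theta_sym: "{u, v} \<in> E \<Longrightarrow> a \<in> X u \<Longrightarrow> b \<in> X v \<Longrightarrow> pw \<theta> u v a b = pw \<theta> v u b a"
  using sym unfolding pw_symmetric_def by blast

lemma fin_bd: "finite (boundary_edges V E A)"
  by (rule finite_subset[of _ "V \<times> V"]) (use finV AV in \<open>auto simp: boundary_edges_def\<close>)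

lemma bdD:
  assumes "(u, v) \<in> boundary_edges V E A"
  shows "u \<in> A" "v \<notin> A" "u \<in> V" "v \<in> V" "{u, v} \<in> E" "{u, v} \<in> edges_in E V"
    "finite (X u)" "finite (X v)" "X v \<noteq> {}" "y u \<in> X u" "y v \<in> X v"
  using assms AV X y by (auto simp: boundary_edges_def edges_in_def)

lemma inD:
  assumes "{u, v} \<in> edges_in E A"
  shows "u \<in> A" "v \<in> A" "u \<in> V" "v \<in> V" "{u, v} \<in> E"
    "finite (X u)" "finite (X v)" "y u \<in> X u" "y v \<in> X v"
  using assms AV X y by (auto simp: edges_in_def)

lemma card_in: "e \<in> edges_in E B \<Longrightarrow> card e = 2"
  using E by (auto simp: edges_in_def)

lemma fin_in: "finite (edges_in E B)"
  using finE by (simp add: edges_in_def)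

lemma edges_in_V: "edges_in E V = E"
  using E by (auto simp: edges_in_def)

text \<open>An edge lies inside \<open>A\<close>, crosses its boundary, or avoids \<open>A\<close>
  and contributes zero. Boundary edges are oriented outwards, so forgetting the orientation is
  injective on them.\<close>

lemma edge_sum_split:
  assumes "\<And>u v. {u, v} \<in> E \<Longrightarrow> g u v = g v u"
    and "\<And>u v. {u, v} \<in> E \<Longrightarrow> u \<notin> A \<Longrightarrow> v \<notin> A \<Longrightarrow> g u v = 0"
  shows "edge_sum E g = edge_sum (edges_in E A) g + (\<Sum>(u, v)\<in>boundary_edges V E A. g u v)"
proof -
  let ?bd = "boundary_edges V E A" and ?I = "edges_in E A"
  let ?C = "(\<lambda>(u, v). {u, v}) ` ?bd"
  have zero: "edge_term g e = 0" if e: "e \<in> E - (?I \<union> ?C)" for e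
  proof -
    obtain u v where uv: "e = {u, v}" using E e by (meson DiffD1 card_2_iff)
    have "u \<notin> A \<and> v \<notin> A"
    proof (rule ccontr)
      assume "\<not> (u \<notin> A \<and> v \<notin> A)"
      then consider "u \<in> A" "v \<in> A" | "u \<in> A" "v \<notin> A" | "u \<notin> A" "v \<in> A" by blast
      then show False
      proof cases
        case 1
        then show False using e uv by (auto simp: edges_in_def)
      next
        case 2
        then have "(u, v) \<in> ?bd" using e uv edge_ends[of u v] by (auto simp: boundary_edges_def)
        then show False using e uv by force
      next
        case 3
        then have "(v, u) \<in> ?bd"
          using e uv edge_ends[of u v] by (auto simp: boundary_edges_def insert_commute)
        then show False using e uv by (force simp: insert_commute)
      qed
    qed
    then show ?thesis using assms[of u v] e uv edge_term_eq[of g u v] by auto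
  qed
  have "edge_sum E g = (\<Sum>e\<in>?I \<union> ?C. edge_term g e)"
    unfolding edge_sum_def
    by (rule sum.mono_neutral_right)
      (use finE zero in \<open>auto simp: edges_in_def boundary_edges_def\<close>)
  also have "\<dots> = edge_sum ?I g + (\<Sum>e\<in>?C. edge_term g e)"
    unfolding edge_sum_def
    by (rule sum.union_disjoint) (use fin_in fin_bd in \<open>auto simp: edges_in_def boundary_edges_def\<close>)
  also have "(\<Sum>e\<in>?C. edge_term g e) = (\<Sum>(u, v)\<in>?bd. edge_term g {u, v})"
    by (subst sum.reindex)
      (auto simp: inj_on_def boundary_edges_def doubleton_eq_iff case_prod_unfold)
  also have "\<dots> = (\<Sum>(u, v)\<in>?bd. g u v)"
    by (rule sum.cong) (auto dest!: bdD(5) intro!: edge_term_eq assms(1))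
  finally show ?thesis .
qed

text \<open>This is the shape of what a reparametrization adds to the unary terms on
  \<open>A\<close>: an inner edge is met from both ends, a boundary edge only from its inner
  end.\<close>

lemma arc_sum_split:
  "(\<Sum>v\<in>A. \<Sum>u | {u, v} \<in> E. h v u) =
     edge_sum (edges_in E A) (\<lambda>u v. h u v + h v u) + (\<Sum>(u, v)\<in>boundary_edges V E A. h u v)"
proof -
  let ?bd = "boundary_edges V E A"
  let ?arcs = "{(u, v). {u, v} \<in> edges_in E A}"
  have fin: "finite {u. {u, v} \<in> E}" for v
    by (rule finite_subset[OF _ finV]) (use edge_ends in auto)
  have "(\<Sum>v\<in>A. \<Sum>u | {u, v} \<in> E. h v u) = (\<Sum>(v, u)\<in>(SIGMA v:A. {u. {u, v} \<in> E}). h v u)"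
    by (rule sum.Sigma) (use finite_subset[OF AV finV] fin in auto)
  also have "(SIGMA v:A. {u. {u, v} \<in> E}) = ?arcs \<union> ?bd"
    using edge_ends by (auto simp: edges_in_def boundary_edges_def insert_commute)
  also have "(\<Sum>(v, u)\<in>?arcs \<union> ?bd. h v u) = (\<Sum>(v, u)\<in>?arcs. h v u) + (\<Sum>(v, u)\<in>?bd. h v u)"
  proof (rule sum.union_disjoint)
    show "finite ?arcs" by (rule edge_sum_arcs(2)[OF fin_in card_in])
    show "?arcs \<inter> ?bd = {}" by (auto simp: edges_in_def boundary_edges_def)
  qed (rule fin_bd)
  finally show ?thesis
    using edge_sum_arcs(1)[OF fin_in card_in, where h = h] by simp
qed

section \<open>The criterion relative to the test labeling\<close>

definition base_energy :: "('v, 'l) pvec \<Rightarrow> real" where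
  "base_energy \<mu> = lin_energy E X A \<theta> \<mu> - lin_energy E X A \<theta> (indicator_vec y)"

definition gain :: "'v \<Rightarrow> 'v \<Rightarrow> 'l \<Rightarrow> real" where
  "gain u v a = Min ((\<lambda>b. pw \<theta> u v a b - pw \<theta> u v (y u) b) ` X v)"

definition boundary_gain :: "('v, 'l) pvec \<Rightarrow> real" where
  "boundary_gain \<mu> = (\<Sum>(u, v)\<in>boundary_edges V E A. \<Sum>a\<in>X u. gain u v a * un \<mu> u a)"

text \<open>Unlike \<open>boundary_gain\<close>, this reads the pairwise blocks of boundary edges,
  so it is meant for relaxed labelings on all of \<open>V\<close>.\<close>

definition boundary_change :: "('v, 'l) pvec \<Rightarrow> real" where
  "boundary_change \<mu> = (\<Sum>(u, v)\<in>boundary_edges V E A. \<Sum>a\<in>X u. \<Sum>b\<in>X v.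
     (pw \<theta> u v a b - pw \<theta> u v (y u) b) * pw \<mu> u v a b)"

definition test_reparam :: "'v \<Rightarrow> 'v \<Rightarrow> 'l \<Rightarrow> real" where
  "test_reparam = (\<lambda>v u a. - pw \<theta> u v (y u) a)"

definition test_map :: "'v \<Rightarrow> 'l \<Rightarrow> 'l" where
  "test_map = (\<lambda>v i. if v \<in> A then y v else i)"

lemma gain_y:
  assumes "X v \<noteq> {}"
  shows "gain u v (y u) = 0"
proof -
  have "(\<lambda>b. pw \<theta> u v (y u) b - pw \<theta> u v (y u) b) ` X v = {0}" using assms by auto
  then show ?thesis by (simp add: gain_def)
qed

text \<open>At \<open>a = y u\<close> the reparametrized potential does not depend on the outer
  label, so its maximum is that constant and the gain is zero. For other labels the term in
  \<open>a\<close> alone is pulled out of the minimum.\<close>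

lemma boundary_pot_reparam:
  assumes "(u, v) \<in> boundary_edges V E A"
  shows "boundary_pot X (reparam E test_reparam \<theta>) u v (y u) a = gain u v a - pw \<theta> v u (y v) a"
proof -
  note d = bdD[OF assms]
  have pw: "pw (reparam E test_reparam \<theta>) u v a
      = (\<lambda>b. (pw \<theta> u v a b - pw \<theta> u v (y u) b) + - pw \<theta> v u (y v) a)" for a
    by (simp add: reparam_def test_reparam_def fun_eq_iff)
  show ?thesis
  proof (cases "a = y u")
    case True
    have "pw (reparam E test_reparam \<theta>) u v (y u) ` X v = {- pw \<theta> v u (y v) (y u)}"
      using d unfolding pw by auto
    then show ?thesis using True gain_y[OF d(9)] by (simp add: boundary_pot_def)
  next
    case False
    then show ?thesis
      using Min_add_commute[OF d(8,9), of "\<lambda>b. pw \<theta> u v a b - pw \<theta> u v (y u) b" "- pw \<theta> v u (y v) a"]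
      unfolding boundary_pot_def pw gain_def by simp
  qed
qed

text \<open>The marginalization constraints make the reparametrization invisible on the edges inside \<open>A\<close>;
  on boundary edges it survives and combines with the boundary potential into the gain.\<close>

lemma hat_energy_eq:
  assumes "\<mu> \<in> local_polytope E X A"
  shows "hat_energy V E X A y (reparam E test_reparam \<theta>) \<mu> = lin_energy E X A \<theta> \<mu> + boundary_gain \<mu>"
proof -
  let ?bd = "boundary_edges V E A" and ?I = "edges_in E A"
  let ?th = "reparam E test_reparam \<theta>"
  note P = local_polytopeD[OF assms]
  \<comment> \<open>The correction that the arc from \<open>u\<close> to \<open>v\<close> adds to
    the unary terms at \<open>u\<close>; it returns with opposite sign in the pairwise or boundary
    terms.\<close>
  define h where "h u v = (\<Sum>a\<in>X u. pw \<theta> v u (y v) a * un \<mu> u a)" for u v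
  have un: "(\<Sum>v\<in>A. \<Sum>a\<in>X v. un ?th v a * un \<mu> v a) =
    (\<Sum>v\<in>A. \<Sum>a\<in>X v. un \<theta> v a * un \<mu> v a) + (\<Sum>v\<in>A. \<Sum>u | {u, v} \<in> E. h v u)"
    unfolding sum.distrib[symmetric]
  proof (rule sum.cong[OF refl])
    fix v assume "v \<in> A"
    have "(\<Sum>u | {u, v} \<in> E. h v u) = (\<Sum>a\<in>X v. (\<Sum>u | {u, v} \<in> E. pw \<theta> u v (y u) a) * un \<mu> v a)"
      unfolding h_def sum_distrib_right by (rule sum.swap)
    then show "(\<Sum>a\<in>X v. un ?th v a * un \<mu> v a)
        = (\<Sum>a\<in>X v. un \<theta> v a * un \<mu> v a) + (\<Sum>u | {u, v} \<in> E. h v u)"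
      by (simp add: reparam_def test_reparam_def sum_negf algebra_simps sum.distrib)
  qed
  have "edge_sum ?I (\<lambda>u v. \<Sum>a\<in>X u. \<Sum>b\<in>X v. pw ?th u v a b * pw \<mu> u v a b) =
    edge_sum ?I (\<lambda>u v. (\<Sum>a\<in>X u. \<Sum>b\<in>X v. pw \<theta> u v a b * pw \<mu> u v a b) - (h u v + h v u))"
  proof (rule edge_sum_cong[OF _ card_in])
    fix u v assume e: "{u, v} \<in> ?I"
    \<comment> \<open>Each unary marginal is spread over the block of the edge: row sums handle the
      end \<open>u\<close>, column sums the end \<open>v\<close>.\<close>
    have 1: "h u v = (\<Sum>a\<in>X u. \<Sum>b\<in>X v. pw \<theta> v u (y v) a * pw \<mu> u v a b)"
      unfolding h_def sum_distrib_left[symmetric] by (rule sum.cong) (use P(5)[OF e] in auto)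
    have "h v u = (\<Sum>b\<in>X v. \<Sum>a\<in>X u. pw \<theta> u v (y u) b * pw \<mu> u v a b)"
      unfolding h_def sum_distrib_left[symmetric] by (rule sum.cong) (use P(6)[OF e] in auto)
    then have 2: "h v u = (\<Sum>a\<in>X u. \<Sum>b\<in>X v. pw \<theta> u v (y u) b * pw \<mu> u v a b)"
      by (simp add: sum.swap[of _ "X u" "X v"])
    show "(\<Sum>a\<in>X u. \<Sum>b\<in>X v. pw ?th u v a b * pw \<mu> u v a b)
      = (\<Sum>a\<in>X u. \<Sum>b\<in>X v. pw \<theta> u v a b * pw \<mu> u v a b) - (h u v + h v u)"
      unfolding 1 2 sum.distrib[symmetric] sum_subtractf[symmetric]
      by (simp add: reparam_def test_reparam_def algebra_simps)
  qed
  then have pw: "edge_sum ?I (\<lambda>u v. \<Sum>a\<in>X u. \<Sum>b\<in>X v. pw ?th u v a b * pw \<mu> u v a b) =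
    edge_sum ?I (\<lambda>u v. \<Sum>a\<in>X u. \<Sum>b\<in>X v. pw \<theta> u v a b * pw \<mu> u v a b)
    - edge_sum ?I (\<lambda>u v. h u v + h v u)"
    by (simp add: edge_sum_diff)
  have "(\<Sum>(u, v)\<in>?bd. \<Sum>a\<in>X u. boundary_pot X ?th u v (y u) a * un \<mu> u a) =
    (\<Sum>(u, v)\<in>?bd. (\<Sum>a\<in>X u. gain u v a * un \<mu> u a) - h u v)"
    by (rule sum.cong)
      (auto simp: boundary_pot_reparam h_def left_diff_distrib sum_subtractf)
  then have bd: "(\<Sum>(u, v)\<in>?bd. \<Sum>a\<in>X u. boundary_pot X ?th u v (y u) a * un \<mu> u a) =
    boundary_gain \<mu> - (\<Sum>(u, v)\<in>?bd. h u v)"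
    by (simp add: boundary_gain_def case_prod_unfold sum_subtractf)
  show ?thesis
    unfolding hat_energy_def lin_energy_def un pw bd arc_sum_split[of h] by simp
qed

lemma indicator_y: "B \<subseteq> V \<Longrightarrow> indicator_vec y \<in> local_polytope E X B"
  by (rule indicator_vec_in_local_polytope) (use X y in auto)

lemma boundary_gain_y: "boundary_gain (indicator_vec y) = 0"
proof -
  have "(\<Sum>a\<in>X u. gain u v a * un (indicator_vec y) u a) = 0"
    if "(u, v) \<in> boundary_edges V E A" for u v
    using bdD[OF that] by (simp add: indicator_vec_def sum_of_bool_mult gain_y)
  then show ?thesis unfolding boundary_gain_def by (auto intro: sum.neutral)
qed

text \<open>Turns minimality of the indicator of \<open>y\<close> into nonnegativity of an
  expression in the original potentials.\<close>

lemma hat_energy_diff: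
  assumes "\<mu> \<in> local_polytope E X A"
  shows "hat_energy V E X A y (reparam E test_reparam \<theta>) \<mu>
    - hat_energy V E X A y (reparam E test_reparam \<theta>) (indicator_vec y)
    = base_energy \<mu> + boundary_gain \<mu>"
  using hat_energy_eq[OF assms] hat_energy_eq[OF indicator_y[OF AV]]
  by (simp add: base_energy_def boundary_gain_y)

text \<open>Moving the value at \<open>y\<close> into the individual summands lets later comparisons
  proceed node by node and edge by edge.\<close>

lemma base_energy_eq:
  "base_energy \<mu> = (\<Sum>v\<in>A. (\<Sum>a\<in>X v. un \<theta> v a * un \<mu> v a) - un \<theta> v (y v))
    + edge_sum (edges_in E A)
       (\<lambda>u v. (\<Sum>a\<in>X u. \<Sum>b\<in>X v. pw \<theta> u v a b * pw \<mu> u v a b) - pw \<theta> u v (y u) (y v))"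
proof -
  have "lin_energy E X A \<theta> (indicator_vec y) =
     (\<Sum>v\<in>A. un \<theta> v (y v)) + edge_sum (edges_in E A) (\<lambda>u v. pw \<theta> u v (y u) (y v))"
    by (rule lin_energy_indicator) (use E X y AV in auto)
  then show ?thesis
    by (simp add: base_energy_def lin_energy_def edge_sum_diff sum_subtractf)
qed

section \<open>The improving objective relative to the test labeling\<close>

text \<open>Column \<open>a\<close> of the matrix has its only one in row
  \<open>test_map v a\<close>, so the transpose pulls potentials back along the map.\<close>

lemma lin_ext_transpose_un:
  assumes "v \<in> V" "a \<in> X v"
  shows "un (lin_ext_transpose X test_map \<theta>) v a = un \<theta> v (test_map v a)"
proof -
  have "test_map v a \<in> X v" using assms y by (simp add: test_map_def)
  then show ?thesis using X[OF assms(1)]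
    by (simp add: lin_ext_transpose_def map_matrix_def sum_of_bool_mult)
qed

lemma lin_ext_transpose_pw:
  assumes "u \<in> V" "v \<in> V" "a \<in> X u" "b \<in> X v"
  shows "pw (lin_ext_transpose X test_map \<theta>) u v a b = pw \<theta> u v (test_map u a) (test_map v b)"
proof -
  have "test_map u a \<in> X u" "test_map v b \<in> X v" using assms y by (simp_all add: test_map_def)
  then show ?thesis
    using X[OF assms(1)] X[OF assms(2)]
    by (simp add: lin_ext_transpose_def map_matrix_def sum_of_bool_mult mult.assoc
        sum_distrib_left[symmetric])
qed

text \<open>Inside \<open>A\<close> the map is constant, and normalization turns the subtracted term
  into the value at \<open>y\<close>. Off \<open>A\<close> it is the identity and everything
  cancels. On a boundary edge only the inner label is replaced, which leaves
  \<open>boundary_change\<close>.\<close>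

lemma improving_objective_eq:
  assumes "\<mu> \<in> local_polytope E X V"
  shows "lin_energy E X V (pvec_diff \<theta> (lin_ext_transpose X test_map \<theta>)) \<mu>
    = base_energy \<mu> + boundary_change \<mu>"
proof -
  let ?bd = "boundary_edges V E A" and ?I = "edges_in E A"
  let ?d = "pvec_diff \<theta> (lin_ext_transpose X test_map \<theta>)"
  note P = local_polytopeD[OF assms, unfolded edges_in_V]
  have un: "(\<Sum>a\<in>X v. un ?d v a * un \<mu> v a) =
    (if v \<in> A then (\<Sum>a\<in>X v. un \<theta> v a * un \<mu> v a) - un \<theta> v (y v) else 0)" if v: "v \<in> V" for v
  proof -
    have "(\<Sum>a\<in>X v. un ?d v a * un \<mu> v a) =
      (\<Sum>a\<in>X v. (un \<theta> v a - un \<theta> v (test_map v a)) * un \<mu> v a)"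
      by (rule sum.cong) (use v lin_ext_transpose_un in \<open>auto simp: pvec_diff_def\<close>)
    then show ?thesis
      using P(2)[OF v]
      by (simp add: test_map_def left_diff_distrib sum_subtractf sum_distrib_left[symmetric])
  qed
  then have un_sum: "(\<Sum>v\<in>V. \<Sum>a\<in>X v. un ?d v a * un \<mu> v a) =
    (\<Sum>v\<in>A. (\<Sum>a\<in>X v. un \<theta> v a * un \<mu> v a) - un \<theta> v (y v))"
    using finV AV by (simp add: sum.If_cases Int_absorb1 cong: sum.cong)
  define g where "g u v = (\<Sum>a\<in>X u. \<Sum>b\<in>X v.
    (pw \<theta> u v a b - pw \<theta> u v (test_map u a) (test_map v b)) * pw \<mu> u v a b)" for u v
  have d: "edge_sum E (\<lambda>u v. \<Sum>a\<in>X u. \<Sum>b\<in>X v. pw ?d u v a b * pw \<mu> u v a b) = edge_sum E g"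
  proof (rule edge_sum_cong)
    fix u v assume "{u, v} \<in> E"
    then show "(\<Sum>a\<in>X u. \<Sum>b\<in>X v. pw ?d u v a b * pw \<mu> u v a b) = g u v"
      unfolding g_def
      by (intro sum.cong refl) (use lin_ext_transpose_pw edge_ends in \<open>auto simp: pvec_diff_def\<close>)
  qed (use E in auto)
  have "edge_sum E g = edge_sum ?I g + (\<Sum>(u, v)\<in>?bd. g u v)"
  proof (rule edge_sum_split)
    fix u v assume e: "{u, v} \<in> E"
    have m: "test_map w a \<in> X w" if "w \<in> V" "a \<in> X w" for w a
      using that y by (simp add: test_map_def)
    show "g u v = g v u"
      unfolding g_def
      by (subst sum.swap, intro sum.cong refl)
        (use e P(3)[OF e] theta_sym[OF e] m edge_ends[OF e] in auto)
    show "g u v = 0" if "u \<notin> A" "v \<notin> A"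
      using that by (simp add: g_def test_map_def)
  qed
  also have "(\<Sum>(u, v)\<in>?bd. g u v) = boundary_change \<mu>"
    unfolding boundary_change_def g_def
    by (rule sum.cong) (auto simp: test_map_def boundary_edges_def)
  also have "edge_sum ?I g = edge_sum ?I
       (\<lambda>u v. (\<Sum>a\<in>X u. \<Sum>b\<in>X v. pw \<theta> u v a b * pw \<mu> u v a b) - pw \<theta> u v (y u) (y v))"
  proof (rule edge_sum_cong[OF _ card_in])
    fix u v assume e: "{u, v} \<in> ?I"
    note i = inD[OF e]
    have "(\<Sum>a\<in>X u. \<Sum>b\<in>X v. pw \<mu> u v a b) = 1"
      using P(5)[OF i(5)] P(2)[OF i(3)] by simp
    then show "g u v = (\<Sum>a\<in>X u. \<Sum>b\<in>X v. pw \<theta> u v a b * pw \<mu> u v a b) - pw \<theta> u v (y u) (y v)"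
      using i by (simp add: g_def test_map_def left_diff_distrib sum_subtractf
          sum_distrib_left[symmetric])
  qed
  finally show ?thesis
    unfolding lin_energy_def edges_in_V un_sum d base_energy_eq by simp
qed

text \<open>Row \<open>a\<close> of the block is nonnegative with sum \<open>un \<mu> u a\<close>,
  and a weighted sum is at least the minimum times the total weight.\<close>

lemma boundary_gain_le_change:
  assumes "\<mu> \<in> local_polytope E X V"
  shows "boundary_gain \<mu> \<le> boundary_change \<mu>"
  unfolding boundary_gain_def boundary_change_def
proof (rule sum_mono, clarify)
  fix u v assume "(u, v) \<in> boundary_edges V E A"
  note d = bdD[OF this] and P = local_polytopeD[OF assms]
  show "(\<Sum>a\<in>X u. gain u v a * un \<mu> u a)
    \<le> (\<Sum>a\<in>X u. \<Sum>b\<in>X v. (pw \<theta> u v a b - pw \<theta> u v (y u) b) * pw \<mu> u v a b)"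
  proof (rule sum_mono)
    fix a assume a: "a \<in> X u"
    have "gain u v a * un \<mu> u a = (\<Sum>b\<in>X v. gain u v a * pw \<mu> u v a b)"
      using P(5)[OF d(6) a] by (simp add: sum_distrib_left[symmetric])
    also have "\<dots> \<le> (\<Sum>b\<in>X v. (pw \<theta> u v a b - pw \<theta> u v (y u) b) * pw \<mu> u v a b)"
      by (intro sum_mono mult_right_mono P(4)[OF d(6) a])
        (use d(8) in \<open>auto simp: gain_def\<close>)
    finally show "gain u v a * un \<mu> u a
      \<le> (\<Sum>b\<in>X v. (pw \<theta> u v a b - pw \<theta> u v (y u) b) * pw \<mu> u v a b)" .
  qed
qed

section \<open>Extending a relaxed labeling from \<open>A\<close> to \<open>V\<close>\<close>

definition best :: "'v \<Rightarrow> 'v \<Rightarrow> 'l \<Rightarrow> 'l" where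
  "best u v a = (SOME b. b \<in> X v \<and> pw \<theta> u v a b - pw \<theta> u v (y u) b = gain u v a)"

lemma best:
  assumes "finite (X v)" "X v \<noteq> {}"
  shows "best u v a \<in> X v"
    and "pw \<theta> u v a (best u v a) - pw \<theta> u v (y u) (best u v a) = gain u v a"
proof -
  have "gain u v a \<in> (\<lambda>b. pw \<theta> u v a b - pw \<theta> u v (y u) b) ` X v"
    unfolding gain_def by (rule Min_in) (use assms in auto)
  then have "\<exists>b. b \<in> X v \<and> pw \<theta> u v a b - pw \<theta> u v (y u) b = gain u v a" by auto
  from someI_ex[OF this] show "best u v a \<in> X v"
    and "pw \<theta> u v a (best u v a) - pw \<theta> u v (y u) (best u v a) = gain u v a"
    unfolding best_def by auto
qed

text \<open>Any positive weight below every \<open>1 / real (card (X v))\<close> would serve. The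
  leading 1 in the denominator keeps it positive even for empty \<open>V\<close>.\<close>

definition shrink :: real where
  "shrink = 1 / (1 + (\<Sum>v\<in>V. real (card (X v))))"

lemma shrink_pos: "0 < shrink" and shrink_le_1: "shrink \<le> 1"
  by (simp_all add: shrink_def add_pos_nonneg sum_nonneg)

lemma shrink_le:
  assumes "v \<in> V"
  shows "shrink \<le> 1 / real (card (X v))"
proof -
  have "real (card (X v)) \<le> (\<Sum>v\<in>V. real (card (X v)))"
    by (rule member_le_sum) (use assms finV in auto)
  moreover have "0 < card (X v)" using X[OF assms] by (simp add: card_gt_0_iff)
  ultimately show ?thesis by (simp add: shrink_def frac_le)
qed

text \<open>A coupling of the shrunk marginal at \<open>u\<close> with the uniform one at
  \<open>v\<close>. Row \<open>y u\<close> is defined as the remainder, so the column sums hold by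
  construction.\<close>

definition boundary_block :: "('v, 'l) pvec \<Rightarrow> 'v \<Rightarrow> 'v \<Rightarrow> 'l \<Rightarrow> 'l \<Rightarrow> real" where
  "boundary_block \<mu> u v a b =
     (if a = y u
      then 1 / real (card (X v)) - shrink * (\<Sum>a'\<in>X u - {y u}. un \<mu> u a' * of_bool (best u v a' = b))
      else shrink * un \<mu> u a * of_bool (best u v a = b))"

text \<open>Shrinking \<open>\<mu>\<close> towards \<open>y\<close> makes room for coupling all boundary edges at an outer node \<open>v\<close> to
  one and the same marginal at \<open>v\<close>, the uniform one: the labels \<open>a \<noteq> y u\<close> carry little mass and are
  sent to their cheapest partners, and the label \<open>y u\<close>, whose cost vanishes, absorbs the rest.\<close>

definition extension :: "('v, 'l) pvec \<Rightarrow> ('v, 'l) pvec" where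
  "extension \<mu> = PVec
     (\<lambda>v a. if v \<in> A then (1 - shrink) * of_bool (y v = a) + shrink * un \<mu> v a
            else 1 / real (card (X v)))
     (\<lambda>u v a b.
        if u \<in> A then
          if v \<in> A then (1 - shrink) * of_bool (y u = a \<and> y v = b) + shrink * pw \<mu> u v a b
          else boundary_block \<mu> u v a b
        else if v \<in> A then boundary_block \<mu> v u b a
        else 1 / real (card (X u)) * (1 / real (card (X v))))"

lemma boundary_block:
  assumes \<mu>: "\<mu> \<in> local_polytope E X A" and u: "u \<in> A" and v: "v \<in> V"
  shows "a \<in> X u \<Longrightarrow> 0 \<le> boundary_block \<mu> u v a b"
    and "a \<in> X u \<Longrightarrow> (\<Sum>b\<in>X v. boundary_block \<mu> u v a b)
      = (1 - shrink) * of_bool (y u = a) + shrink * un \<mu> u a"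
    and "(\<Sum>a\<in>X u. boundary_block \<mu> u v a b) = 1 / real (card (X v))"
proof -
  note P = local_polytopeD[OF \<mu>]
  have uV: "u \<in> V" using u AV by auto
  have fu: "finite (X u)" "y u \<in> X u" using X[OF uV] y[OF uV] by auto
  have fv: "finite (X v)" "X v \<noteq> {}" using X[OF v] by auto
  let ?S = "X u - {y u}"
  have S: "(\<Sum>a'\<in>?S. un \<mu> u a') = 1 - un \<mu> u (y u)"
    using P(2)[OF u] fu by (simp add: sum_diff1)
  \<comment> \<open>Worst case for the remainder row: all labels other than \<open>y u\<close> share
    the partner \<open>b\<close>. Even then the mass sent there is at most \<open>shrink\<close>,
    which fits into the uniform marginal.\<close>
  have "(\<Sum>a'\<in>?S. un \<mu> u a' * of_bool (best u v a' = b)) \<le> (\<Sum>a'\<in>?S. un \<mu> u a')"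
    by (rule sum_mono) (use P(1)[OF u] in \<open>auto simp: of_bool_def\<close>)
  also have "\<dots> \<le> 1" using S P(1)[OF u fu(2)] by simp
  finally have "shrink * (\<Sum>a'\<in>?S. un \<mu> u a' * of_bool (best u v a' = b)) \<le> shrink * 1"
    using shrink_pos by (intro mult_left_mono) auto
  then have le: "shrink * (\<Sum>a'\<in>?S. un \<mu> u a' * of_bool (best u v a' = b)) \<le> 1 / real (card (X v))"
    using shrink_le[OF v] by simp
  show "0 \<le> boundary_block \<mu> u v a b" if "a \<in> X u"
    using le P(1)[OF u that] shrink_pos by (simp add: boundary_block_def)
  show "(\<Sum>b\<in>X v. boundary_block \<mu> u v a b)
      = (1 - shrink) * of_bool (y u = a) + shrink * un \<mu> u a" if "a \<in> X u"
  proof (cases "a = y u")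
    case True
    \<comment> \<open>Each \<open>a'\<close> is counted exactly once because its partner lies in
      \<open>X v\<close>. The uniform marginal has total 1, so the remainder row sums to
      \<open>1 - shrink * (1 - un \<mu> u (y u))\<close>.\<close>
    have "(\<Sum>b\<in>X v. \<Sum>a'\<in>?S. un \<mu> u a' * of_bool (best u v a' = b))
        = (\<Sum>a'\<in>?S. \<Sum>b\<in>X v. un \<mu> u a' * of_bool (best u v a' = b))"
      by (rule sum.swap)
    also have "\<dots> = 1 - un \<mu> u (y u)"
      using S by (simp add: sum_of_bool_mult fv best)
    finally show ?thesis
      using True fv by (simp add: boundary_block_def sum_subtractf sum_distrib_left[symmetric]
          right_diff_distrib)
  next
    case False
    then show ?thesis using fv by (simp add: boundary_block_def sum_of_bool_mult best)
  qed
  have "(\<Sum>a\<in>?S. boundary_block \<mu> u v a b)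
      = shrink * (\<Sum>a'\<in>?S. un \<mu> u a' * of_bool (best u v a' = b))"
    by (auto simp: boundary_block_def sum_distrib_left mult.assoc intro!: sum.cong)
  then show "(\<Sum>a\<in>X u. boundary_block \<mu> u v a b) = 1 / real (card (X v))"
    using fu by (subst sum.remove[of _ "y u"]) (simp_all add: boundary_block_def[of \<mu> u v "y u"])
qed

text \<open>Inner edges carry a convex combination of two feasible blocks, edges off
  \<open>A\<close> a product of uniform marginals, and boundary edges the coupling above, transposed
  when the first end is the outer one.\<close>

lemma extension_in_local_polytope:
  assumes \<mu>: "\<mu> \<in> local_polytope E X A"
  shows "extension \<mu> \<in> local_polytope E X V"
proof -
  note P = local_polytopeD[OF \<mu>] and B = boundary_block[OF \<mu>]
  note s = shrink_pos shrink_le_1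
  have inA: "{u, v} \<in> edges_in E A" if "{u, v} \<in> E" "u \<in> A" "v \<in> A" for u v
    using that by (simp add: edges_in_def)
  have sym: "pw (extension \<mu>) u v a b = pw (extension \<mu>) v u b a"
    if "{u, v} \<in> E" "a \<in> X u" "b \<in> X v" for u v a b
    using that P(3)[OF inA] by (auto simp: extension_def conj_commute)
  have un_nonneg: "0 \<le> un (extension \<mu>) v a" if "v \<in> V" "a \<in> X v" for v a
    using that P(1) s by (auto simp: extension_def)
  have un_sum: "(\<Sum>a\<in>X v. un (extension \<mu>) v a) = 1" if v: "v \<in> V" for v
    using X[OF v] y[OF v] P(2)[of v]
    by (cases "v \<in> A") (simp_all add: extension_def sum.distrib sum_distrib_left[symmetric] sum_of_bool_mult)
  have nonneg: "0 \<le> pw (extension \<mu>) u v a b"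
    if e: "{u, v} \<in> E" "a \<in> X u" "b \<in> X v" for u v a b
    using e edge_ends[OF e(1)] P(4)[OF inA] s B(1) by (auto simp: extension_def)
  have marg: "(\<Sum>b\<in>X v. pw (extension \<mu>) u v a b) = un (extension \<mu>) u a"
    if e: "{u, v} \<in> E" and a: "a \<in> X u" for u v a
  proof -
    note d = edge_ends[OF e]
    have f: "finite (X v)" "X v \<noteq> {}" "y v \<in> X v" using X[OF d(2)] y[OF d(2)] by auto
    consider "u \<in> A" "v \<in> A" | "u \<in> A" "v \<notin> A" | "u \<notin> A" "v \<in> A" | "u \<notin> A" "v \<notin> A" by blast
    then show ?thesis
    proof cases
      case 1
      then show ?thesis
        using P(5)[OF inA[OF e 1] a] f
        by (simp add: extension_def sum.distrib sum_distrib_left[symmetric] of_bool_conj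
            sum_of_bool_mult)
    next
      case 2
      then show ?thesis using B(2)[OF _ d(2) a] by (simp add: extension_def)
    next
      case 3
      then show ?thesis using B(3)[OF _ d(1)] by (simp add: extension_def)
    next
      case 4
      then show ?thesis using f by (simp add: extension_def)
    qed
  qed
  \<comment> \<open>By symmetry, column sums are row sums of the reversed edge.\<close>
  have marg': "(\<Sum>a\<in>X u. pw (extension \<mu>) u v a b) = un (extension \<mu>) v b"
    if e: "{u, v} \<in> E" and b: "b \<in> X v" for u v b
  proof -
    have e': "{v, u} \<in> E" using e by (simp add: insert_commute)
    have "(\<Sum>a\<in>X u. pw (extension \<mu>) u v a b) = (\<Sum>a\<in>X u. pw (extension \<mu>) v u b a)"
      by (rule sum.cong) (use sym e b in auto)
    then show ?thesis using marg[OF e' b] by simp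
  qed
  show ?thesis
    unfolding local_polytope_def edges_in_V pw_symmetric_def
    using sym un_nonneg un_sum nonneg marg marg' by blast
qed

text \<open>On \<open>A\<close> the extension is a convex combination of the indicator of
  \<open>y\<close> and \<open>\<mu>\<close> with weight \<open>shrink\<close> on
  \<open>\<mu>\<close>, and \<open>base_energy\<close> is affine and vanishes at
  \<open>y\<close>.\<close>

lemma base_energy_extension: "base_energy (extension \<mu>) = shrink * base_energy \<mu>"
proof -
  have un: "(\<Sum>a\<in>X v. un \<theta> v a * un (extension \<mu>) v a) - un \<theta> v (y v)
      = shrink * ((\<Sum>a\<in>X v. un \<theta> v a * un \<mu> v a) - un \<theta> v (y v))" if v: "v \<in> A" for v
  proof -
    have f: "finite (X v)" "y v \<in> X v" using v AV X y by auto
    have "(\<Sum>a\<in>X v. un \<theta> v a * un (extension \<mu>) v a)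
      = (\<Sum>a\<in>X v. (1 - shrink) * (un \<theta> v a * of_bool (y v = a)) + shrink * (un \<theta> v a * un \<mu> v a))"
      using v by (intro sum.cong) (auto simp: extension_def algebra_simps)
    also have "\<dots> = (1 - shrink) * un \<theta> v (y v) + shrink * (\<Sum>a\<in>X v. un \<theta> v a * un \<mu> v a)"
      using f by (simp only: sum.distrib sum_distrib_left[symmetric] sum_of_bool_mult)
    finally show ?thesis by (simp add: algebra_simps)
  qed
  have pw: "(\<Sum>a\<in>X u. \<Sum>b\<in>X v. pw \<theta> u v a b * pw (extension \<mu>) u v a b) - pw \<theta> u v (y u) (y v)
      = shrink * ((\<Sum>a\<in>X u. \<Sum>b\<in>X v. pw \<theta> u v a b * pw \<mu> u v a b) - pw \<theta> u v (y u) (y v))"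
    if "{u, v} \<in> edges_in E A" for u v
  proof -
    note i = inD[OF that]
    have "(\<Sum>a\<in>X u. \<Sum>b\<in>X v. pw \<theta> u v a b * pw (extension \<mu>) u v a b)
      = (\<Sum>a\<in>X u. \<Sum>b\<in>X v. (1 - shrink) * (of_bool (y u = a \<and> y v = b) * pw \<theta> u v a b)
          + shrink * (pw \<theta> u v a b * pw \<mu> u v a b))"
      using i by (intro sum.cong refl) (auto simp: extension_def algebra_simps)
    also have "\<dots> = (1 - shrink) * pw \<theta> u v (y u) (y v)
        + shrink * (\<Sum>a\<in>X u. \<Sum>b\<in>X v. pw \<theta> u v a b * pw \<mu> u v a b)"
      using i by (simp only: sum.distrib sum_distrib_left[symmetric] sum_of_bool_conj_mult)
    finally show ?thesis by (simp add: algebra_simps)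
  qed
  show ?thesis
    unfolding base_energy_eq
    by (simp add: un edge_sum_cong[OF pw card_in] edge_sum_scale sum_distrib_left[symmetric]
        distrib_left)
qed

text \<open>The remainder row \<open>y u\<close> has cost zero whatever its entries are, and every
  other row puts its whole mass on a label attaining the gain.\<close>

lemma boundary_change_extension: "boundary_change (extension \<mu>) = shrink * boundary_gain \<mu>"
proof -
  have "(\<Sum>b\<in>X v. (pw \<theta> u v a b - pw \<theta> u v (y u) b) * pw (extension \<mu>) u v a b)
      = shrink * (gain u v a * un \<mu> u a)" if "(u, v) \<in> boundary_edges V E A" for u v a
  proof (cases "a = y u")
    case True
    then show ?thesis using gain_y[OF bdD(9)[OF that]] by simp
  next
    case False
    note d = bdD[OF that]
    have "(\<Sum>b\<in>X v. (pw \<theta> u v a b - pw \<theta> u v (y u) b) * pw (extension \<mu>) u v a b)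
      = (\<Sum>b\<in>X v. ((pw \<theta> u v a b - pw \<theta> u v (y u) b) * (shrink * un \<mu> u a)) * of_bool (best u v a = b))"
      using False d(1,2) by (intro sum.cong) (auto simp: extension_def boundary_block_def)
    also have "\<dots> = gain u v a * (shrink * un \<mu> u a)"
      using best[OF d(8,9)] by (subst sum_of_bool_mult(2)[OF d(8)]) auto
    finally show ?thesis by simp
  qed
  then show ?thesis
    unfolding boundary_change_def boundary_gain_def
    by (auto simp: sum_distrib_left intro!: sum.cong)
qed

section \<open>Equivalence of the two conditions\<close>

lemma boundary_change_y: "boundary_change (indicator_vec y) = 0"
  unfolding boundary_change_def
  by (rule sum.neutral) (auto simp: indicator_vec_def of_bool_def intro!: sum.neutral)

lemma criterion_iff_improving:
  "is_arg_min (hat_energy V E X A y (reparam E test_reparam \<theta>))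
     (\<lambda>\<mu>. \<mu> \<in> local_polytope E X A) (indicator_vec y)
   \<longleftrightarrow> improving V E X test_map \<theta>"
proof -
  let ?c = "lin_energy E X V (pvec_diff \<theta> (lin_ext_transpose X test_map \<theta>))"
  have "?c (indicator_vec y) = 0"
    using improving_objective_eq[OF indicator_y[OF order_refl]]
    by (simp add: base_energy_def boundary_change_y)
  \<comment> \<open>The indicator of \<open>y\<close> is feasible with value zero, so it witnesses
    the minimum as soon as the objective is nonnegative.\<close>
  then have "improving V E X test_map \<theta> \<longleftrightarrow> (\<forall>\<mu>\<in>local_polytope E X V. 0 \<le> ?c \<mu>)"
    unfolding improving_def Let_def is_arg_min_linorder
    using indicator_y[OF order_refl] by (metis)
  also have "\<dots> \<longleftrightarrow> (\<forall>\<mu>\<in>local_polytope E X A. 0 \<le> base_energy \<mu> + boundary_gain \<mu>)"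
  proof (intro iffI ballI)
    fix \<mu>
    assume "\<forall>\<mu>\<in>local_polytope E X V. 0 \<le> ?c \<mu>" and "\<mu> \<in> local_polytope E X A"
    \<comment> \<open>Both parts of the objective at the extension scale by the same positive
      factor, which can then be cancelled.\<close>
    then have "0 \<le> shrink * (base_energy \<mu> + boundary_gain \<mu>)"
      using extension_in_local_polytope[of \<mu>] improving_objective_eq[of "extension \<mu>"]
      by (auto simp: base_energy_extension boundary_change_extension distrib_left)
    then show "0 \<le> base_energy \<mu> + boundary_gain \<mu>"
      using shrink_pos by (simp add: zero_le_mult_iff)
  next
    fix \<mu>
    assume "\<forall>\<mu>\<in>local_polytope E X A. 0 \<le> base_energy \<mu> + boundary_gain \<mu>"
      and \<mu>: "\<mu> \<in> local_polytope E X V"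
    then have "0 \<le> base_energy \<mu> + boundary_gain \<mu>"
      using local_polytope_mono[OF AV] by blast
    then show "0 \<le> ?c \<mu>"
      using improving_objective_eq[OF \<mu>] boundary_gain_le_change[OF \<mu>] by linarith
  qed
  also have "\<dots> \<longleftrightarrow> is_arg_min (hat_energy V E X A y (reparam E test_reparam \<theta>))
     (\<lambda>\<mu>. \<mu> \<in> local_polytope E X A) (indicator_vec y)"
    unfolding is_arg_min_linorder
    using indicator_y[OF AV] hat_energy_diff by (metis diff_ge_0_iff_ge)
  finally show ?thesis by blast
qed

end

theorem lemma5:
  fixes V A :: "'v set" and E :: "'v set set" and X :: "'v \<Rightarrow> 'l set"
    and \<theta> :: "('v, 'l) pvec" and y :: "'v \<Rightarrow> 'l"
    and \<psi> :: "'v \<Rightarrow> 'v \<Rightarrow> 'l \<Rightarrow> real" and p :: "'v \<Rightarrow> 'l \<Rightarrow> 'l"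
  assumes "finite V"
    and "\<And>e. e \<in> E \<Longrightarrow> e \<subseteq> V \<and> card e = 2"
    and "\<And>v. v \<in> V \<Longrightarrow> finite (X v) \<and> X v \<noteq> {}"
    and "pw_symmetric E X \<theta>"
    and "A \<subseteq> V"
    and "\<And>v. v \<in> V \<Longrightarrow> y v \<in> X v"
    and "\<psi> = (\<lambda>v u x\<^sub>v. - pw \<theta> u v (y u) x\<^sub>v)"
    and "p = (\<lambda>v i. if v \<in> A then y v else i)"
  shows "is_arg_min (hat_energy V E X A y (reparam E \<psi> \<theta>))
           (\<lambda>\<mu>. \<mu> \<in> local_polytope E X A) (indicator_vec y)
         \<longleftrightarrow> improving V E X p \<theta>"
proof -
  interpret test_labeling V A E X \<theta> y
    using assms(1-6) by unfold_locales
  show ?thesis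
    using criterion_iff_improving unfolding assms(7,8) test_reparam_def test_map_def .
qed

end
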